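(* Let $C$ be the Cartan matrix of a root system $\mathcal{R}$ with basis of simple roots $\mathcal{R}_0$, let $\mathcal{W}$ be the corresponding Weyl group, and let $(,)$ and $d_\alpha=\frac12(\alpha,\alpha)$ be normalized such that $d_\alpha\in\mathbb{Z}$ for all $\alpha\in\mathcal{R}$ and at least one $d_\alpha=1$, so that in particular $(\alpha,\beta)\in\mathbb{Z}$ for all $\alpha,\beta\in\mathcal{R}$. Let $\mathcal{G}$ be the graph with node set $\mathcal{R}_0$ and an edge between $\alpha\neq\beta$ whenever $(\alpha,\beta)\equiv 1\bmod 2$. Suppose $F=(f,V)$ is a minimal symplectic root system over $\mathbb{F}_2$ on $\mathcal{G}$. Then the decoration $f:\mathcal{R}_0\to V$ can be additively extended to a map $\tilde f:\mathcal{R}\to V$. Furthermore, there is an action of $\mathcal{W}$ on $V$ by symplectic isomorphisms such that $\tilde f$ intertwines the $\mathcal{W}$-actions on $\mathcal{R}$ and $V$, i.e. $\tilde f(w\beta)=w\tilde f(\beta)$ for all $w\in\mathcal{W},\beta\in\mathcal{R}$; in particular $\mathcal{W}$ maps the set $\tilde f(\mathcal{R})\subset V$ to itself.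
   Context: A (finite) root system is a subset $\mathcal{R}$ of a Euclidean vector space $(E,(,))$ over $\mathbb{R}$ such that: $\mathcal{R}$ is finite, spans $E$ and $0\notin\mathcal{R}$; for $\alpha\in\mathcal{R}$ the only multiples of $\alpha$ in $\mathcal{R}$ are $\pm\alpha$; for $\alpha\in\mathcal{R}$ the reflection $\sigma_\alpha(\beta)=\beta-\frac{2(\alpha,\beta)}{(\alpha,\alpha)}\alpha$ leaves $\mathcal{R}$ invariant; and $\frac{2(\alpha,\beta)}{(\alpha,\alpha)}\in\mathbb{Z}$ for $\alpha,\beta\in\mathcal{R}$. A basis of simple roots $\mathcal{R}_0\subset\mathcal{R}$ is a basis of $E$ such that all roots are integer linear combinations of $\mathcal{R}_0$ with all coefficients nonnegative or all nonpositive. The Cartan matrix is $C_{\alpha,\beta}=\frac{2(\alpha,\beta)}{(\alpha,\alpha)}=d_\alpha^{-1}(\alpha,\beta)$ for $\alpha\ne\beta\in\mathcal{R}_0$, and $C_{\alpha,\alpha}=2$. The Weyl group $\mathcal{W}$ is the group generated by the reflections $\sigma_\alpha$, $\alpha\in\mathcal{R}$. Additively extended means $\tilde f\left(\sum_{\alpha\in\mathcal{R}_0}n_\alpha\alpha\right)=\sum_{\alpha\in\mathcal{R}_0} n_\alpha f(\alpha)$ for every root $\sum n_\alpha\alpha\in\mathcal{R}$ with $n_\alpha\in\mathbb{Z}$. A symplectic vector space over a field $\Bbbk$ is a finite-dimensional $\Bbbk$-vector space $V$ with a (possibly degenerate) bilinear form $\langle,\rangle$ such that $\langle v,v\rangle=0$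 for all $v$. A symplectic isomorphism is a bijective linear map preserving the forms. A symplectic root system $F=(f,V)$ over $\mathbb{F}_2$ on a finite graph $\mathcal{G}$ consists of a symplectic vector space $V$ over $\mathbb{F}_2$ and a map $f$ from the nodes of $\mathcal{G}$ to $V$ such that $f(\mathcal{G})$ generates $V$, and two nodes $\alpha,\beta$ are adjacent if and only if $\langle f(\alpha),f(\beta)\rangle\neq 0$. It is minimal if the family $\{f(\alpha)\}_{\alpha\in\mathcal{G}}$ is a basis of $V$. *)

theory Defs
  imports
    "HOL-Analysis.Analysis"
    "HOL-Algebra.Elementary_Groups"
    "HOL-Algebra.Group_Action"
    "HOL-Library.Z2"
    "HOL-Library.Real_Mod"
begin

section \<open>Root systems\<close>

text \<open>The Cartan matrix of a root system with simple roots \<open>R0\<close> is the restriction of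
  \<open>cartan\<close> to \<open>R0 \<times> R0\<close>.\<close>

definition cartan :: "'a::euclidean_space \<Rightarrow> 'a \<Rightarrow> real" where
  "cartan \<alpha> \<beta> = 2 * (\<alpha> \<bullet> \<beta>) / (\<alpha> \<bullet> \<alpha>)"

definition half_norm :: "'a::euclidean_space \<Rightarrow> real" where
  "half_norm \<alpha> = (\<alpha> \<bullet> \<alpha>) / 2"

definition root_reflection :: "'a::euclidean_space \<Rightarrow> 'a \<Rightarrow> 'a" where
  "root_reflection \<alpha> \<beta> = \<beta> - cartan \<alpha> \<beta> *\<^sub>R \<alpha>"

definition root_system :: "'a::euclidean_space set \<Rightarrow> bool" where
  "root_system R \<longleftrightarrow>
     finite R \<and> span R = UNIV \<and> 0 \<notin> R \<and>
     (\<forall>\<alpha>\<in>R. R \<inter> range (\<lambda>c. c *\<^sub>R \<alpha>) = {\<alpha>, - \<alpha>}) \<and>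
     (\<forall>\<alpha>\<in>R. root_reflection \<alpha> ` R = R) \<and>
     (\<forall>\<alpha>\<in>R. \<forall>\<beta>\<in>R. cartan \<alpha> \<beta> \<in> \<int>)"

definition simple_roots :: "'a::euclidean_space set \<Rightarrow> 'a set \<Rightarrow> bool" where
  "simple_roots R R0 \<longleftrightarrow>
     R0 \<subseteq> R \<and> independent R0 \<and> span R0 = UNIV \<and>
     (\<forall>\<beta>\<in>R. \<exists>n :: 'a \<Rightarrow> int. \<beta> = (\<Sum>\<alpha>\<in>R0. of_int (n \<alpha>) *\<^sub>R \<alpha>) \<and>
        ((\<forall>\<alpha>\<in>R0. n \<alpha> \<ge> 0) \<or> (\<forall>\<alpha>\<in>R0. n \<alpha> \<le> 0)))"

text \<open>The ambient group is that of all bijections of the Euclidean space, under composition, so an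
  element \<open>w\<close> acts on \<open>\<beta>\<close> as \<open>w \<beta>\<close>.\<close>

definition weyl_group :: "'a::euclidean_space set \<Rightarrow> ('a \<Rightarrow> 'a) monoid" where
  "weyl_group R = subgroup_generated (BijGroup UNIV) (root_reflection ` R)"

definition odd_adjacent :: "'a::euclidean_space \<Rightarrow> 'a \<Rightarrow> bool" where
  "odd_adjacent \<alpha> \<beta> \<longleftrightarrow> \<alpha> \<noteq> \<beta> \<and> [\<alpha> \<bullet> \<beta> = 1] (rmod 2)"

text \<open>\<open>subgroup_generated\<close> intersects its generators with the carrier; nothing is lost here.\<close>

lemma root_reflection_in_BijGroup:
  assumes "\<alpha> \<noteq> 0"
  shows "root_reflection \<alpha> \<in> carrier (BijGroup UNIV)"
proof -
  have "root_reflection \<alpha> (root_reflection \<alpha> \<beta>) = \<beta>" for \<beta>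
    using assms by (simp add: root_reflection_def cartan_def algebra_simps)
  then have "bij (root_reflection \<alpha>)"
    by (metis bijI')
  then show ?thesis
    by (simp add: BijGroup_def Bij_def)
qed

section \<open>Symplectic spaces and symplectic root systems\<close>

definition finite_graph :: "'n set \<Rightarrow> ('n \<Rightarrow> 'n \<Rightarrow> bool) \<Rightarrow> bool" where
  "finite_graph N adj \<longleftrightarrow>
     finite N \<and> (\<forall>x\<in>N. \<not> adj x x) \<and> (\<forall>x\<in>N. \<forall>y\<in>N. adj x y \<longrightarrow> adj y x)"

lemma finite_graph_odd_adjacent: "finite R0 \<Longrightarrow> finite_graph R0 odd_adjacent"
  by (auto simp: finite_graph_def odd_adjacent_def inner_commute)

text \<open>The form may be degenerate. The whole type \<open>'v\<close> is the vector space.\<close>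

locale symplectic_space = vector_space smul
  for smul :: "'k::field \<Rightarrow> 'v::ab_group_add \<Rightarrow> 'v" +
  fixes form :: "'v \<Rightarrow> 'v \<Rightarrow> 'k"
  assumes finite_dimensional: "\<exists>B. finite B \<and> span B = UNIV"
    and form_linear_left: "Vector_Spaces.linear smul (*) (\<lambda>u. form u v)"
    and form_linear_right: "Vector_Spaces.linear smul (*) (form u)"
    and form_alternating: "form v v = 0"

definition symplectic_iso ::
  "('k::field \<Rightarrow> 'v::ab_group_add \<Rightarrow> 'v) \<Rightarrow> ('v \<Rightarrow> 'v \<Rightarrow> 'k) \<Rightarrow>
   ('k \<Rightarrow> 'w::ab_group_add \<Rightarrow> 'w) \<Rightarrow> ('w \<Rightarrow> 'w \<Rightarrow> 'k) \<Rightarrow> ('v \<Rightarrow> 'w) \<Rightarrow> bool" where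
  "symplectic_iso smul form smul' form' g \<longleftrightarrow>
     Vector_Spaces.linear smul smul' g \<and> bij g \<and>
     (\<forall>u v. form' (g u) (g v) = form u v)"

text \<open>The field of two elements is the type \<^typ>\<open>bit\<close>.\<close>

locale symplectic_root_system = symplectic_space smul form
  for smul :: "bit \<Rightarrow> 'v::ab_group_add \<Rightarrow> 'v" and form :: "'v \<Rightarrow> 'v \<Rightarrow> bit" +
  fixes N :: "'n set" and adj :: "'n \<Rightarrow> 'n \<Rightarrow> bool" and f :: "'n \<Rightarrow> 'v"
  assumes graph: "finite_graph N adj"
    and generates: "span (f ` N) = UNIV"
    and adj_iff: "\<lbrakk>x \<in> N; y \<in> N\<rbrakk> \<Longrightarrow> adj x y \<longleftrightarrow> form (f x) (f y) \<noteq> 0"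

text \<open>A basis as a family: the vectors \<open>f x\<close> are also pairwise distinct. Spanning is inherited.\<close>

locale minimal_symplectic_root_system = symplectic_root_system +
  assumes family_inj: "inj_on f N"
    and family_independent: "independent (f ` N)"

definition additive_extension ::
  "(bit \<Rightarrow> 'v::ab_group_add \<Rightarrow> 'v) \<Rightarrow> 'a::euclidean_space set \<Rightarrow> 'a set \<Rightarrow>
   ('a \<Rightarrow> 'v) \<Rightarrow> ('a \<Rightarrow> 'v) \<Rightarrow> bool" where
  "additive_extension smul R R0 f f' \<longleftrightarrow>
     (\<forall>n :: 'a \<Rightarrow> int. (\<Sum>\<alpha>\<in>R0. of_int (n \<alpha>) *\<^sub>R \<alpha>) \<in> R \<longrightarrow>
        f' (\<Sum>\<alpha>\<in>R0. of_int (n \<alpha>) *\<^sub>R \<alpha>) = (\<Sum>\<alpha>\<in>R0. smul (of_int (n \<alpha>)) (f \<alpha>)))"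

end

theory Submission
  imports Defs
begin

text \<open>A minimal symplectic root system over the field of two elements is the root lattice \<open>L\<close>
  reduced modulo 2, \<open>V = L / 2L\<close>, with \<open>f\<close> the class of a simple root and the form the reduction
  of \<open>(,)\<close>; the latter is alternating because \<open>(\<alpha>,\<alpha>) = 2 d\<^sub>\<alpha>\<close> is even. The Weyl group acts on \<open>L\<close> by
  isometries, hence on the quotient, and the reduction \<open>L \<rightarrow> V\<close> is equivariant.\<close>

section \<open>The lattice spanned by a basis\<close>

text \<open>The integer span of a basis. Encoded by integrality of coordinates, so that closure and
  halving become coordinatewise checks. Since \<open>representation\<close> defaults to 0 for a
  dependent set and off the span, the set is this lattice only when \<open>B\<close> is a basis of
  the whole space.\<close>

definition int_lattice :: "'a::euclidean_space set \<Rightarrow> 'a set" where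
  "int_lattice B = {x. \<forall>\<alpha>\<in>B. representation B x \<alpha> \<in> \<int>}"

locale euclidean_basis =
  fixes B :: "'a::euclidean_space set"
  assumes basis_independent: "independent B"
    and basis_span: "span B = UNIV"
begin

abbreviation "coord \<equiv> representation B"

lemma finite_basis: "finite B"
  using basis_independent by (rule independent_imp_finite)

lemma coord_add: "coord (x + y) \<alpha> = coord x \<alpha> + coord y \<alpha>"
  using representation_add[OF basis_independent, of y x] basis_span by simp

lemma coord_scale: "coord (c *\<^sub>R x) \<alpha> = c * coord x \<alpha>"
  using representation_scale[OF basis_independent, of x c] basis_span by simp

lemma coord_diff: "coord (x - y) \<alpha> = coord x \<alpha> - coord y \<alpha>"
  using coord_add[of "x - y" y] by simp

lemma sum_coord: "(\<Sum>\<alpha>\<in>B. coord x \<alpha> *\<^sub>R \<alpha>) = x"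
  using real_vector.sum_representation_eq[OF basis_independent _ finite_basis, of x] basis_span
  by simp

lemma coord_basis: "\<alpha> \<in> B \<Longrightarrow> coord \<alpha> = (\<lambda>\<beta>. if \<beta> = \<alpha> then 1 else 0)"
  by (rule representation_basis[OF basis_independent])

lemma coord_sum:
  assumes "\<beta> \<in> B"
  shows "coord (\<Sum>\<alpha>\<in>B. c \<alpha> *\<^sub>R \<alpha>) \<beta> = c \<beta>"
proof -
  have "coord (\<Sum>\<alpha>\<in>B. c \<alpha> *\<^sub>R \<alpha>) \<beta> = (\<Sum>\<alpha>\<in>B. coord (c \<alpha> *\<^sub>R \<alpha>) \<beta>)"
    using representation_sum[OF basis_independent, of B "\<lambda>\<alpha>. c \<alpha> *\<^sub>R \<alpha>"] basis_span by simp
  also have "\<dots> = (\<Sum>\<alpha>\<in>B. if \<alpha> = \<beta> then c \<alpha> else 0)"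
    by (rule sum.cong) (auto simp: coord_scale coord_basis)
  finally show ?thesis
    using assms finite_basis by simp
qed

lemma int_sum_in_lattice: "(\<Sum>\<alpha>\<in>B. of_int (n \<alpha>) *\<^sub>R \<alpha>) \<in> int_lattice B"
  by (simp add: int_lattice_def coord_sum)

lemma lattice_add: "x \<in> int_lattice B \<Longrightarrow> y \<in> int_lattice B \<Longrightarrow> x + y \<in> int_lattice B"
  by (simp add: int_lattice_def coord_add)

lemma lattice_scale: "x \<in> int_lattice B \<Longrightarrow> of_int n *\<^sub>R x \<in> int_lattice B"
  by (simp add: int_lattice_def coord_scale)

lemma lattice_sum: "(\<And>i. i \<in> I \<Longrightarrow> g i \<in> int_lattice B) \<Longrightarrow> sum g I \<in> int_lattice B"
proof (induction I rule: infinite_finite_induct)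
  case (insert i I)
  then show ?case by (simp add: lattice_add)
\<comment> \<open>The empty sum and the sum over an infinite set are both 0, the combination with
  all coefficients 0.\<close>
qed (use int_sum_in_lattice[of "\<lambda>_. 0"] in simp_all)

text \<open>Integral coordinates are fixed by the floor, which serves throughout as the passage from
  integer-valued reals back to \<open>int\<close>.\<close>

lemma lattice_expansion:
  assumes "x \<in> int_lattice B"
  shows "x = (\<Sum>\<alpha>\<in>B. of_int \<lfloor>coord x \<alpha>\<rfloor> *\<^sub>R \<alpha>)"
proof -
  have "(\<Sum>\<alpha>\<in>B. of_int \<lfloor>coord x \<alpha>\<rfloor> *\<^sub>R \<alpha>) = (\<Sum>\<alpha>\<in>B. coord x \<alpha> *\<^sub>R \<alpha>)"
    using assms by (intro sum.cong) (auto simp: int_lattice_def)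
  then show ?thesis
    by (simp add: sum_coord)
qed

text \<open>By linearity \<open>g x\<close> is the same integer combination of the vectors
  \<open>g \<alpha>\<close>. It will be applied to Weyl group elements, which send simple roots to
  roots.\<close>

lemma linear_maps_lattice:
  assumes "linear g" "g ` B \<subseteq> int_lattice B" "x \<in> int_lattice B"
  shows "g x \<in> int_lattice B"
proof -
  have "g x = g (\<Sum>\<alpha>\<in>B. of_int \<lfloor>coord x \<alpha>\<rfloor> *\<^sub>R \<alpha>)"
    using lattice_expansion[OF assms(3)] by (rule arg_cong)
  also have "\<dots> = (\<Sum>\<alpha>\<in>B. of_int \<lfloor>coord x \<alpha>\<rfloor> *\<^sub>R g \<alpha>)"
    by (simp add: linear_sum[OF assms(1)] linear_scale[OF assms(1)])
  also have "\<dots> \<in> int_lattice B"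
    using assms(2) by (intro lattice_sum lattice_scale) auto
  finally show ?thesis .
qed

end

section \<open>Reduction modulo 2\<close>

lemma of_int_bit_eq_0_iff: "(of_int k :: bit) = 0 \<longleftrightarrow> even k"
proof (cases "even k")
  case True
  then obtain m where "k = 2 * m"
    by (rule evenE)
  then show ?thesis
    by simp
next
  case False
  then obtain m where "k = 2 * m + 1"
    by (rule oddE)
  then show ?thesis
    by simp
qed

text \<open>The projection of the lattice onto its quotient by 2, in coordinates. The floor makes it
  total; additivity is claimed on lattice vectors only.\<close>

definition reduce_mod2 ::
  "(bit \<Rightarrow> 'v::ab_group_add \<Rightarrow> 'v) \<Rightarrow> 'a::euclidean_space set \<Rightarrow> ('a \<Rightarrow> 'v) \<Rightarrow> 'a \<Rightarrow> 'v" where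
  "reduce_mod2 smul B f x = (\<Sum>\<alpha>\<in>B. smul (of_int \<lfloor>representation B x \<alpha>\<rfloor>) (f \<alpha>))"

text \<open>The map on the quotient, computed on an arbitrary lattice preimage of \<open>v\<close>.
  A preimage exists by \<open>red_surj\<close>, and \<open>ind_red\<close> shows that the choice
  does not matter.\<close>

definition induced_mod2 ::
  "(bit \<Rightarrow> 'v::ab_group_add \<Rightarrow> 'v) \<Rightarrow> 'a::euclidean_space set \<Rightarrow> ('a \<Rightarrow> 'v) \<Rightarrow> ('a \<Rightarrow> 'a) \<Rightarrow> 'v \<Rightarrow> 'v"
  where "induced_mod2 smul B f g v =
    reduce_mod2 smul B f (g (SOME x. x \<in> int_lattice B \<and> reduce_mod2 smul B f x = v))"

text \<open>Independence is given for the set of values; injectivity transports coefficients along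
  \<open>inv_into N f\<close>, which makes it usable for the indexed family.\<close>

lemma (in vector_space) independent_family_unique:
  assumes "finite N" "inj_on f N" "independent (f ` N)"
    and "(\<Sum>i\<in>N. scale (c i) (f i)) = 0" "i \<in> N"
  shows "c i = 0"
proof -
  have "(\<Sum>v\<in>f ` N. scale (c (inv_into N f v)) v) = (\<Sum>i\<in>N. scale (c i) (f i))"
    using assms(2) by (simp add: sum.reindex)
  then have "c (inv_into N f (f i)) = 0"
    using independentD[OF assms(3), of "f ` N" "\<lambda>v. c (inv_into N f v)" "f i"] assms by simp
  then show ?thesis
    using assms by simp
qed

text \<open>The only scalars are 0 and 1, so homogeneity reduces to \<open>g 0 = 0\<close>.\<close>

lemma bit_additive_imp_linear:
  fixes s :: "bit \<Rightarrow> 'v::ab_group_add \<Rightarrow> 'v"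
  assumes "vector_space s" and add: "\<And>x y. g (x + y) = g x + g y"
  shows "Vector_Spaces.linear s s g"
proof -
  interpret s: vector_space s by fact
  have "g 0 = 0"
    using add[of 0 0] by simp
  then have "g (s c x) = s c (g x)" for c x
    by (cases c) simp_all
  then show ?thesis
    unfolding Vector_Spaces.linear_iff using assms by simp
qed

text \<open>Isolates what the reduction argument takes from the root system. Prescribing the form on
  basis pairs suffices, since the form and the inner product modulo 2 are both bilinear on the
  lattice.\<close>

locale mod2_lattice = euclidean_basis B + minimal_symplectic_root_system smul form B adj f
  for B :: "'a::euclidean_space set"
    and smul :: "bit \<Rightarrow> 'v::ab_group_add \<Rightarrow> 'v" and form :: "'v \<Rightarrow> 'v \<Rightarrow> bit"
    and adj :: "'a \<Rightarrow> 'a \<Rightarrow> bool" and f :: "'a \<Rightarrow> 'v" +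
  assumes basis_inner_Ints: "\<alpha> \<in> B \<Longrightarrow> \<beta> \<in> B \<Longrightarrow> \<alpha> \<bullet> \<beta> \<in> \<int>"
    and form_basis: "\<alpha> \<in> B \<Longrightarrow> \<beta> \<in> B \<Longrightarrow> form (f \<alpha>) (f \<beta>) = of_int \<lfloor>\<alpha> \<bullet> \<beta>\<rfloor>"
begin

abbreviation "lat \<equiv> int_lattice B"
abbreviation "red \<equiv> reduce_mod2 smul B f"
abbreviation "ind \<equiv> induced_mod2 smul B f"

text \<open>Coordinates in a basis are unique. This is the formula demanded of the additive
  extension.\<close>

lemma red_int_sum: "red (\<Sum>\<alpha>\<in>B. of_int (n \<alpha>) *\<^sub>R \<alpha>) = (\<Sum>\<alpha>\<in>B. smul (of_int (n \<alpha>)) (f \<alpha>))"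
  unfolding reduce_mod2_def by (rule sum.cong) (simp_all add: coord_sum)

lemma red_add:
  assumes "x \<in> lat" "y \<in> lat"
  shows "red (x + y) = red x + red y"
proof -
  have "\<lfloor>coord (x + y) \<alpha>\<rfloor> = \<lfloor>coord x \<alpha>\<rfloor> + \<lfloor>coord y \<alpha>\<rfloor>"
    if "\<alpha> \<in> B" for \<alpha>
    using assms that by (auto simp: int_lattice_def coord_add elim!: Ints_cases)
  then have "red (x + y) = (\<Sum>\<alpha>\<in>B. smul (of_int \<lfloor>coord x \<alpha>\<rfloor>) (f \<alpha>) +
      smul (of_int \<lfloor>coord y \<alpha>\<rfloor>) (f \<alpha>))"
    unfolding reduce_mod2_def
    by (intro sum.cong) (simp_all add: scale_left_distrib del: add_bit_eq_xor)
  then show ?thesis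
    by (simp add: sum.distrib reduce_mod2_def)
qed

text \<open>Scalars have characteristic 2, so \<open>1 + 1\<close> acts as 0.\<close>

lemma red_double:
  assumes "x \<in> lat"
  shows "red (2 *\<^sub>R x) = 0"
proof -
  have "red x + red x = smul (1 + 1) (red x)"
    unfolding scale_left_distrib by simp
  then show ?thesis
    using red_add[OF assms assms] by (simp add: scaleR_2)
qed

text \<open>The kernel of the reduction is twice the lattice, and minimality enters here: a
  vanishing combination of the basis vectors \<open>f \<alpha>\<close> has zero coefficients, so all
  coordinates of \<open>x - y\<close> are even and its half is again a lattice vector.\<close>

lemma red_eq_imp_diff_double:
  assumes "x \<in> lat" "y \<in> lat" "red x = red y"
  obtains z where "z \<in> lat" "x = y + 2 *\<^sub>R z"
proof
  define z where "z = (1/2) *\<^sub>R (x - y)"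
  show "x = y + 2 *\<^sub>R z"
    by (simp add: z_def)
  have d: "x - y \<in> lat"
    using assms by (simp add: int_lattice_def coord_diff)
  have "red (x - y) = 0"
    using red_add[OF d assms(2)] assms(3) by simp
  then have "even \<lfloor>coord (x - y) \<alpha>\<rfloor>" if "\<alpha> \<in> B" for \<alpha>
    using independent_family_unique[OF finite_basis family_inj family_independent _ that,
        of "\<lambda>\<alpha>. of_int \<lfloor>coord (x - y) \<alpha>\<rfloor>"]
    by (simp add: reduce_mod2_def of_int_bit_eq_0_iff)
  moreover have "coord (x - y) \<alpha> = of_int \<lfloor>coord (x - y) \<alpha>\<rfloor>" if "\<alpha> \<in> B" for \<alpha>
    using d that by (auto simp: int_lattice_def)
  ultimately have "\<exists>k::int. coord (x - y) \<alpha> = 2 * of_int k" if "\<alpha> \<in> B" for \<alpha>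
    using that by (metis evenE of_int_mult of_int_numeral)
  then show "z \<in> lat"
    by (fastforce simp: int_lattice_def z_def coord_scale)
qed

text \<open>Induction along the span of the generators \<open>f \<alpha>\<close>, each of which
  lifts to the simple vector \<open>\<alpha>\<close>.\<close>

lemma red_surj: "red ` lat = UNIV"
proof -
  have "v \<in> red ` lat" for v
  proof -
    have "v \<in> span (f ` B)"
      using generates by simp
    then show ?thesis
    proof (induction rule: span_induct_alt)
      case base
      show ?case
        using red_int_sum[of "\<lambda>_. 0"] int_sum_in_lattice[of "\<lambda>_. 0"] by (auto intro: rev_image_eqI)
    next
      case (step c u v)
      then obtain \<alpha> y where \<alpha>: "\<alpha> \<in> B" "u = f \<alpha>" and y: "y \<in> lat" "v = red y"
        by auto
      have \<alpha>L: "\<alpha> \<in> lat"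
        by (simp add: int_lattice_def coord_basis[OF \<alpha>(1)])
      have "red \<alpha> = (\<Sum>\<beta>\<in>B. if \<beta> = \<alpha> then f \<beta> else 0)"
        unfolding reduce_mod2_def
        by (rule sum.cong) (simp_all add: coord_basis[OF \<alpha>(1)])
      then have "red \<alpha> = u"
        using \<alpha> finite_basis by simp
      \<comment> \<open>A scalar is 0 or 1, so adding \<open>smul c u\<close> lifts to adding
        nothing or adding \<open>\<alpha>\<close>.\<close>
      then have "smul c u + v = (if c = 0 then red y else red (\<alpha> + y))"
        using red_add[OF \<alpha>L y(1)] y by (cases c) auto
      then show ?case
        using y lattice_add[OF \<alpha>L y(1)] by auto
    qed
  qed
  then show ?thesis
    by auto
qed

section \<open>The form as the inner product modulo 2\<close>

text \<open>Exhibits the inner product as the cast of an explicit integer, so that its floor is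
  known and can be compared with \<open>form_sums\<close>.\<close>

lemma inner_int_sums:
  "(\<Sum>\<alpha>\<in>B. of_int (m \<alpha>) *\<^sub>R \<alpha>) \<bullet> (\<Sum>\<beta>\<in>B. of_int (n \<beta>) *\<^sub>R \<beta>) =
    of_int (\<Sum>\<alpha>\<in>B. \<Sum>\<beta>\<in>B. m \<alpha> * n \<beta> * \<lfloor>\<alpha> \<bullet> \<beta>\<rfloor>)"
proof -
  have "\<alpha> \<bullet> \<beta> = of_int \<lfloor>\<alpha> \<bullet> \<beta>\<rfloor>" if "\<alpha> \<in> B" "\<beta> \<in> B" for \<alpha> \<beta>
    using basis_inner_Ints[OF that] by simp
  then show ?thesis
    by (subst sum.swap) (simp add: inner_sum_left inner_sum_right sum_distrib_left mult_ac)
qed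

lemma form_sums:
  "form (\<Sum>\<alpha>\<in>B. smul (a \<alpha>) (f \<alpha>)) (\<Sum>\<beta>\<in>B. smul (b \<beta>) (f \<beta>)) =
    (\<Sum>\<alpha>\<in>B. \<Sum>\<beta>\<in>B. a \<alpha> * b \<beta> * form (f \<alpha>) (f \<beta>))"
proof -
  interpret l: Vector_Spaces.linear smul "(*)" "\<lambda>u. form u v" for v
    by (rule form_linear_left)
  interpret r: Vector_Spaces.linear smul "(*)" "form u" for u
    by (rule form_linear_right)
  show ?thesis
    by (subst sum.swap)
      (simp add: l.sum l.scale r.sum r.scale sum_distrib_left mult_ac del: mult_bit_eq_and)
qed

text \<open>Both sides expand to the same double sum over the basis, because \<open>of_int\<close>
  is a ring homomorphism to \<open>bit\<close> and \<open>form_basis\<close> matches the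
  terms.\<close>

lemma form_red:
  assumes "x \<in> lat" "y \<in> lat"
  shows "form (red x) (red y) = of_int \<lfloor>x \<bullet> y\<rfloor>"
proof -
  let ?m = "\<lambda>z \<alpha>. \<lfloor>coord z \<alpha>\<rfloor>"
  have "x \<bullet> y = of_int (\<Sum>\<alpha>\<in>B. \<Sum>\<beta>\<in>B. ?m x \<alpha> * ?m y \<beta> * \<lfloor>\<alpha> \<bullet> \<beta>\<rfloor>)"
    using inner_int_sums[of "?m x" "?m y"] assms[THEN lattice_expansion] by metis
  moreover have "form (red x) (red y) = of_int (\<Sum>\<alpha>\<in>B. \<Sum>\<beta>\<in>B. ?m x \<alpha> * ?m y \<beta> * \<lfloor>\<alpha> \<bullet> \<beta>\<rfloor>)"
    by (simp add: reduce_mod2_def form_sums form_basis del: mult_bit_eq_and)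
  ultimately show ?thesis
    by (simp only: floor_of_int)
qed

section \<open>Maps induced on the quotient\<close>

text \<open>Well-definedness: the chosen preimage differs from \<open>x\<close> by
  \<open>2 z\<close>, which \<open>g\<close> sends to \<open>2 g z\<close>, and the reduction kills
  it.\<close>

lemma ind_red:
  assumes "linear g" "g ` lat \<subseteq> lat" "x \<in> lat"
  shows "ind g (red x) = red (g x)"
proof -
  let ?y = "SOME y. y \<in> lat \<and> red y = red x"
  have y: "?y \<in> lat \<and> red ?y = red x"
    by (rule someI) (use assms(3) in simp)
  then obtain z where z: "z \<in> lat" "?y = x + 2 *\<^sub>R z"
    using red_eq_imp_diff_double assms(3) by metis
  have g: "g x \<in> lat" "g z \<in> lat" "2 *\<^sub>R g z \<in> lat"
    using assms z(1) lattice_scale[of "g z" 2] by auto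
  have "red (g ?y) = red (g x + 2 *\<^sub>R g z)"
    using z(2) by (simp add: linear_add[OF assms(1)] linear_scale[OF assms(1)])
  also have "\<dots> = red (g x)"
    using red_add[OF g(1,3)] red_double[OF g(2)] by simp
  finally show ?thesis
    by (simp add: induced_mod2_def)
qed

text \<open>Every vector of the quotient is some \<open>red x\<close>, where \<open>ind_red\<close>
  evaluates both sides. This will give the homomorphism law of the action.\<close>

lemma ind_compose:
  assumes "linear g" "g ` lat \<subseteq> lat" "linear h" "h ` lat \<subseteq> lat"
  shows "ind (g \<circ> h) = ind g \<circ> ind h"
proof
  fix v
  obtain x where x: "x \<in> lat" "v = red x"
    using red_surj by (metis UNIV_I imageE)
  have "linear (g \<circ> h)" "(g \<circ> h) ` lat \<subseteq> lat" "h x \<in> lat"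
    using assms x by (auto intro: linear_compose)
  then show "ind (g \<circ> h) v = (ind g \<circ> ind h) v"
    using assms x by (simp add: ind_red)
qed

lemma ind_symplectic_iso:
  assumes "linear g" "\<And>x y. g x \<bullet> g y = x \<bullet> y" "g ` lat = lat"
  shows "symplectic_iso smul form smul form (ind g)"
proof -
  have sub: "g ` lat \<subseteq> lat"
    using assms by simp
  have ind: "ind g (red x) = red (g x)" if "x \<in> lat" for x
    using that by (rule ind_red[OF assms(1) sub])
  have g: "g x \<in> lat" if "x \<in> lat" for x
    using that assms(3) by blast
  have lift: "\<exists>x\<in>lat. v = red x" for v
    using red_surj by (metis UNIV_I imageE)
  have add: "ind g (u + v) = ind g u + ind g v" for u v
  proof -
    obtain x y where "x \<in> lat" "u = red x" "y \<in> lat" "v = red y"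
      using lift by metis
    then show ?thesis
      using linear_add[OF assms(1), of x y]
      by (simp add: ind g lattice_add flip: red_add)
  qed
  then have lin: "Vector_Spaces.linear smul smul (ind g)"
    using bit_additive_imp_linear vector_space_axioms by blast
  have "range (ind g) = ind g ` red ` lat"
    by (simp add: red_surj)
  also have "\<dots> = red ` g ` lat"
    by (simp add: image_image ind)
  finally have surj: "surj (ind g)"
    by (simp add: assms(3) red_surj)
  have "inj (ind g)"
  proof (rule injI)
    fix u v
    assume eq: "ind g u = ind g v"
    obtain x y where xy: "x \<in> lat" "u = red x" "y \<in> lat" "v = red y"
      using lift by metis
    then obtain z where z: "z \<in> lat" "g x = g y + 2 *\<^sub>R z"
      using eq red_eq_imp_diff_double[OF g[OF xy(1)] g[OF xy(3)]] by (auto simp: ind)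
    \<comment> \<open>The difference has to be twice the image of a lattice vector, which is where
      \<open>g\<close> being onto the lattice is used.\<close>
    then obtain z' where z': "z' \<in> lat" "z = g z'"
      using assms(3) by blast
    \<comment> \<open>An isometry has trivial kernel, so the relation between \<open>g x\<close> and
      \<open>g y\<close> pulls back to \<open>x\<close> and \<open>y\<close>.\<close>
    define e where "e = x - (y + 2 *\<^sub>R z')"
    have "g e = 0"
      using z z' by (simp add: e_def linear_diff[OF assms(1)] linear_add[OF assms(1)] linear_scale[OF assms(1)])
    then have "e = 0"
      using assms(2)[of e e] by simp
    then have "x = y + 2 *\<^sub>R z'"
      by (simp add: e_def)
    then show "u = v"
      using red_add[OF xy(3) lattice_scale[of z' 2]] red_double[OF z'(1)] xy z'(1) by simp
  qed
  moreover have "form (ind g u) (ind g v) = form u v" for u v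
  proof -
    obtain x y where "x \<in> lat" "u = red x" "y \<in> lat" "v = red y"
      using lift by metis
    then show ?thesis
      by (simp add: ind g form_red assms(2))
  qed
  ultimately show ?thesis
    using lin surj by (simp add: symplectic_iso_def bij_def)
qed

end

section \<open>The Weyl group\<close>

lemma linear_root_reflection: "linear (root_reflection \<alpha>)"
  by (rule linearI)
    (simp_all add: root_reflection_def cartan_def inner_add_right algebra_simps add_divide_distrib)

lemma root_reflection_involution: "\<alpha> \<noteq> 0 \<Longrightarrow> root_reflection \<alpha> (root_reflection \<alpha> x) = x"
  by (simp add: root_reflection_def cartan_def algebra_simps)

lemma inner_root_reflection:
  assumes "\<alpha> \<noteq> 0"
  shows "root_reflection \<alpha> x \<bullet> root_reflection \<alpha> y = x \<bullet> y"
  using assms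
  by (simp add: root_reflection_def cartan_def inner_diff_left inner_diff_right inner_commute field_simps)

lemma mult_BijGroup_UNIV:
  assumes "g \<in> carrier (BijGroup UNIV)" "h \<in> carrier (BijGroup UNIV)"
  shows "g \<otimes>\<^bsub>BijGroup UNIV\<^esub> h = g \<circ> h"
  using assms by (simp add: BijGroup_def compose_def comp_def restrict_def)

lemma one_BijGroup_UNIV: "\<one>\<^bsub>BijGroup UNIV\<^esub> = id"
  by (simp add: BijGroup_def id_def restrict_def)

lemma group_weyl_group: "group (weyl_group R)"
  unfolding weyl_group_def by (intro group.group_subgroup_generated group_BijGroup)

lemma weyl_group_subset: "carrier (weyl_group R) \<subseteq> carrier (BijGroup UNIV)"
  unfolding weyl_group_def by (rule group.carrier_subgroup_generated_subset[OF group_BijGroup])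

text \<open>Induction on the generation of \<open>w\<close>: all three properties hold for
  reflections in roots and survive composition.\<close>

lemma weyl_group_isometry:
  assumes "root_system R" "w \<in> carrier (weyl_group R)"
  shows "linear w \<and> (\<forall>x y. w x \<bullet> w y = x \<bullet> y) \<and> w ` R = R"
proof -
  have nz: "\<alpha> \<noteq> 0" if "\<alpha> \<in> R" for \<alpha>
    using assms(1) that by (auto simp: root_system_def)
  let ?G = "BijGroup (UNIV :: 'a set)"
  let ?P = "\<lambda>w :: 'a \<Rightarrow> 'a. linear w \<and> (\<forall>x y. w x \<bullet> w y = x \<bullet> y) \<and> w ` R = R"
  have refl: "?P (root_reflection \<alpha>)" if "\<alpha> \<in> R" for \<alpha>
    using assms(1) that nz[OF that]
    by (simp add: linear_root_reflection inner_root_reflection root_system_def)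
  have gen: "generate ?G (carrier ?G \<inter> root_reflection ` R) \<subseteq> carrier ?G"
    by (intro group.generate_incl group_BijGroup) auto
  have "w \<in> generate ?G (carrier ?G \<inter> root_reflection ` R)"
    using assms(2) by (simp add: weyl_group_def carrier_subgroup_generated)
  then show ?thesis
  proof (induction rule: generate.induct)
    case one
    show ?case
      by (simp add: one_BijGroup_UNIV linear_id[unfolded id_def])
  next
    case (incl h)
    then obtain \<alpha> where "\<alpha> \<in> R" "h = root_reflection \<alpha>"
      by auto
    then show ?case
      using refl by simp
  next
    case (inv h)
    then obtain \<alpha> where \<alpha>: "\<alpha> \<in> R" "h = root_reflection \<alpha>" "h \<in> carrier ?G"
      by auto
    \<comment> \<open>Only generators are inverted in \<open>generate\<close>, and a reflection is
      its own inverse.\<close>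
    have "h \<otimes>\<^bsub>?G\<^esub> h = \<one>\<^bsub>?G\<^esub>"
      unfolding mult_BijGroup_UNIV[OF \<alpha>(3,3)]
      using \<alpha> nz by (auto simp: one_BijGroup_UNIV root_reflection_involution)
    then have "inv\<^bsub>?G\<^esub> h = h"
      using group.inv_equality[OF group_BijGroup] \<alpha>(3) by blast
    then show ?case
      using refl \<alpha> by simp
  next
    case (eng g h)
    have "g \<otimes>\<^bsub>?G\<^esub> h = g \<circ> h"
      using eng gen by (intro mult_BijGroup_UNIV) auto
    moreover have "linear (g \<circ> h)" "(g \<circ> h) ` R = R"
      using eng by (simp_all add: linear_compose image_comp[symmetric] del: o_apply)
    moreover have "\<forall>x y. (g \<circ> h) x \<bullet> (g \<circ> h) y = x \<bullet> y"
      using eng by simp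
    ultimately show ?case
      by metis
  qed
qed

section \<open>Integrality and parity of inner products\<close>

text \<open>The inner product is the Cartan integer times the integer
  \<open>half_norm \<alpha>\<close>.\<close>

lemma root_system_inner_Ints:
  assumes "root_system R" "\<forall>\<alpha>\<in>R. half_norm \<alpha> \<in> \<int>" "\<alpha> \<in> R" "\<beta> \<in> R"
  shows "\<alpha> \<bullet> \<beta> \<in> \<int>"
proof -
  have "\<alpha> \<bullet> \<beta> = cartan \<alpha> \<beta> * half_norm \<alpha>"
    using assms by (auto simp: root_system_def cartan_def half_norm_def)
  then show ?thesis
    using assms by (simp add: root_system_def)
qed

text \<open>Translates the real congruence in \<open>odd_adjacent\<close> into parity of an
  integer.\<close>

lemma rcong_1_mod2_iff_odd: "[of_int k = 1] (rmod 2) \<longleftrightarrow> odd k"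
proof -
  have "[of_int k = 1] (rmod 2) \<longleftrightarrow> of_int k rmod 2 = 1"
    by (simp add: rcong_def rmod_def)
  also have "of_int k rmod 2 = of_int (k mod 2)"
    using floor_divide_of_int_eq[of k 2, where ?'a = real]
    by (simp add: rmod_def flip: minus_mult_div_eq_mod)
  finally show ?thesis
    by (simp add: odd_iff_mod_2_eq_one)
qed

theorem theorem7p2:
  fixes R R0 :: "'a::euclidean_space set"
    and smul :: "bit \<Rightarrow> 'v::ab_group_add \<Rightarrow> 'v"
    and form :: "'v \<Rightarrow> 'v \<Rightarrow> bit"
    and f :: "'a \<Rightarrow> 'v"
  assumes "root_system R"
    and "simple_roots R R0"
    and "\<forall>\<alpha>\<in>R. half_norm \<alpha> \<in> \<int>"
    and "\<exists>\<alpha>\<in>R. half_norm \<alpha> = 1"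
    and "minimal_symplectic_root_system smul form R0 odd_adjacent f"
  shows "(\<forall>\<alpha>\<in>R. \<forall>\<beta>\<in>R. \<alpha> \<bullet> \<beta> \<in> \<int>) \<and>
    (\<exists>f'. additive_extension smul R R0 f f' \<and>
      (\<exists>\<phi>. group_action (weyl_group R) UNIV \<phi> \<and>
        (\<forall>w\<in>carrier (weyl_group R). symplectic_iso smul form smul form (\<phi> w)) \<and>
        (\<forall>w\<in>carrier (weyl_group R). \<forall>\<beta>\<in>R. f' (w \<beta>) = \<phi> w (f' \<beta>)) \<and>
        (\<forall>w\<in>carrier (weyl_group R). \<phi> w ` (f' ` R) = f' ` R)))"
proof -
  have Ints: "\<alpha> \<bullet> \<beta> \<in> \<int>" if "\<alpha> \<in> R" "\<beta> \<in> R" for \<alpha> \<beta>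
    using root_system_inner_Ints assms that by blast
  have sub: "R0 \<subseteq> R"
    using assms(2) by (simp add: simple_roots_def)
  interpret minimal_symplectic_root_system smul form R0 odd_adjacent f
    by fact
  interpret mod2_lattice R0 smul form odd_adjacent f
  proof
    show "\<not> Real_Vector_Spaces.dependent R0" "Real_Vector_Spaces.span R0 = UNIV"
      using assms(2) by (simp_all add: simple_roots_def)
  next
    fix \<alpha> \<beta>
    assume \<alpha>\<beta>: "\<alpha> \<in> R0" "\<beta> \<in> R0"
    then show "\<alpha> \<bullet> \<beta> \<in> \<int>"
      using Ints sub by blast
    then obtain k where k: "\<alpha> \<bullet> \<beta> = of_int k"
      by (rule Ints_cases)
    \<comment> \<open>On the diagonal the alternating form meets the even number
      \<open>2 * half_norm \<alpha>\<close>; off the diagonal adjacency decides both sides.\<close>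
    have "form (f \<alpha>) (f \<beta>) = 0 \<longleftrightarrow> even k"
    proof (cases "\<alpha> = \<beta>")
      case True
      obtain m where "half_norm \<alpha> = of_int m"
        using assms(3) \<alpha>\<beta> sub by (meson Ints_cases subsetD)
      then have "of_int k = (of_int (2 * m) :: real)"
        using k True by (simp add: half_norm_def)
      then have "k = 2 * m"
        by (simp only: of_int_eq_iff)
      then show ?thesis
        using True by (simp add: form_alternating)
    next
      case False
      then show ?thesis
        using adj_iff[OF \<alpha>\<beta>] by (auto simp: odd_adjacent_def k rcong_1_mod2_iff_odd)
    qed
    \<comment> \<open>Two elements of \<open>bit\<close> that vanish under the same condition are
      equal.\<close>
    then show "form (f \<alpha>) (f \<beta>) = of_int \<lfloor>\<alpha> \<bullet> \<beta>\<rfloor>"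
      using of_int_bit_eq_0_iff[of k] by (metis bit_not_zero_iff floor_of_int k)
  qed
  have R_lat: "R \<subseteq> lat"
    using assms(2) int_sum_in_lattice by (fastforce simp: simple_roots_def)
  have W: "linear w" "\<And>x y. w x \<bullet> w y = x \<bullet> y" "w ` R = R" if "w \<in> carrier (weyl_group R)" for w
    using weyl_group_isometry[OF assms(1) that] by auto
  have W_comp: "g \<otimes>\<^bsub>weyl_group R\<^esub> h = g \<circ> h"
    if "g \<in> carrier (weyl_group R)" "h \<in> carrier (weyl_group R)" for g h
    using mult_BijGroup_UNIV that[THEN subsetD[OF weyl_group_subset]]
    by (simp add: weyl_group_def)
  have W_lat_sub: "w ` lat \<subseteq> lat" if w: "w \<in> carrier (weyl_group R)" for w
    using linear_maps_lattice[OF W(1)[OF w]] W(3)[OF w] sub R_lat by blast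
  \<comment> \<open>The inclusion for \<open>w\<close> and the one for its inverse together give
    equality.\<close>
  have W_lat: "w ` lat = lat" if w: "w \<in> carrier (weyl_group R)" for w
  proof -
    let ?v = "inv\<^bsub>weyl_group R\<^esub> w"
    have v: "?v \<in> carrier (weyl_group R)"
      using w by (simp add: group.inv_closed group_weyl_group)
    have "w \<circ> ?v = id"
      using W_comp[OF w v] group.r_inv[OF group_weyl_group w]
      by (simp add: weyl_group_def one_BijGroup_UNIV)
    then have "lat = w ` ?v ` lat"
      by (simp add: image_comp)
    then show ?thesis
      using W_lat_sub[OF v] W_lat_sub[OF w] by blast
  qed
  have iso: "symplectic_iso smul form smul form (ind w)" if "w \<in> carrier (weyl_group R)" for w
    using that by (intro ind_symplectic_iso W W_lat)
  have equivariant: "red (w \<beta>) = ind w (red \<beta>)" if "w \<in> carrier (weyl_group R)" "\<beta> \<in> R" for w \<beta>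
    using ind_red[OF W(1) W_lat_sub] that R_lat by auto
  have carr: "ind w \<in> carrier (BijGroup UNIV)" if "w \<in> carrier (weyl_group R)" for w
    using iso[OF that] by (simp add: symplectic_iso_def BijGroup_def Bij_def)
  have "group_action (weyl_group R) UNIV ind"
    unfolding group_action_def group_hom_def group_hom_axioms_def
  proof (intro conjI group_weyl_group group_BijGroup homI)
    fix g h
    assume "g \<in> carrier (weyl_group R)" "h \<in> carrier (weyl_group R)"
    then show "ind (g \<otimes>\<^bsub>weyl_group R\<^esub> h) = ind g \<otimes>\<^bsub>BijGroup UNIV\<^esub> ind h"
      by (simp add: W_comp mult_BijGroup_UNIV carr ind_compose W W_lat_sub)
  qed (rule carr)
  moreover have "additive_extension smul R R0 f red"
    by (simp add: additive_extension_def red_int_sum)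
  moreover have "ind w ` red ` R = red ` R" if "w \<in> carrier (weyl_group R)" for w
  proof -
    have "ind w ` red ` R = red ` w ` R"
      using equivariant[OF that] by (simp add: image_image)
    then show ?thesis
      using W(3)[OF that] by simp
  qed
  \<comment> \<open>The reduction itself is the extension of \<open>f\<close>, and the induced maps
    form the action.\<close>
  ultimately show ?thesis
    by (intro conjI ballI exI[of _ red] exI[of _ ind] Ints iso equivariant)
qed

end
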